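(* Let $\sigma$ and $\tau$ be types of an integer $n\ge 1$. The coefficient of $h^\otimes_\tau$ in the $h^\otimes$-expansion of $P_\sigma$ is $$\sum_T \mathrm{sgn}(T)\,\mathrm{wt}(T)=(-1)^{\ell(\sigma)-\ell(\tau)}\sum_T \mathrm{wt}(T),$$ where both sums are over all constant wrapping block tabloids $T$ of shape $\sigma$ and content $\tau$.
   Context: **Types.** A composition is a finite (possibly empty) list $\beta$ of positive integers, with $\mathrm{area}(\beta)$ the sum of its entries and $\ell(\beta)$ its length. A partition is a weakly decreasing composition; $\mathrm{sort}(\beta)$ is the partition obtained by sorting $\beta$. An ordered type of $n$ is a sequence $\delta=(\delta|_1,\delta|_2,\ldots)$ of compositions with $\sum_i i\,\mathrm{area}(\delta|_i)=n$, written $\delta=1^{\delta|_1}2^{\delta|_2}\cdots$; its length is $\ell(\delta)=\sum_i\ell(\delta|_i)$. A type is an ordered type with all $\delta|_i$ partitions, and $\mathrm{psort}(\delta)$ is the type obtained by replacing each $\delta|_i$ by $\mathrm{sort}(\delta|_i)$. A block $d^r$ ($d,r\ge1$) is the ordered type with $\delta|_d=(r)$ and all other $\delta|_i$ empty. A type $\tau$ is identified with the multiset of its blocks (one copy of $d^r$ for each part $r$ of $\tau|_d$), and we list its blocks as $d_1^{r_1}d_2^{r_2}\cdots d_k^{r_k}$. **Polysymmetric functions.** Let $x_{ij}$ ($i,j\ge1$) be commuting indeterminates with $\deg x_{ij}=i$. $\mathrm{PSym}$ is the $\mathbb{Q}$-algebra of bounded-degree formal power series in the $x_{ij}$ invariant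 under swapping $x_{ij}$ and $x_{ik}$ for all $i,j,k$; $\mathrm{PSym}(n)$ is its degree $n$ part. For an ordered type $\delta$, $h^\otimes_\delta=\prod_i h_{\delta|_i}(x_{i1},x_{i2},\ldots)$ where $h_\beta=\prod_j h_{\beta_j}$ is a product of complete homogeneous symmetric functions; $\{h^\otimes_\tau\}$ over types $\tau$ of $n$ is a basis of $\mathrm{PSym}(n)$, and the $h^\otimes$-expansion is the expansion in this basis. $P_d=\sum_{k\mid d}k\sum_{j\ge1}x_{kj}^{d/k}$; $P_{d^r}$ is obtained from $P_d$ by replacing each $x_{ij}$ by $x_{ij}^r$; and $P_\sigma=\prod_{i=1}^kP_{d_i^{r_i}}$ for $\sigma=d_1^{r_1}\cdots d_k^{r_k}$. **Wrappings.** View the block $d^r$ as an array of boxes with $d$ rows and $r$ columns. For $k\mid d$, divide the rows from top to bottom into $d/k$ "$k$-sheets" of $k$ consecutive rows. List all $dr/k$ columns of $k$-sheets (each having $k$ boxes) in reading order: the columns of the first sheet left to right, then of the second sheet left to right, and so on. For a composition $\beta=(\beta_1,\ldots,\beta_l)$ of $dr/k$, the $k$-wrapping of $d^r$ of content $\beta$ is the set partition $B=(B_1,\ldots,B_l)$ of the boxes in which $B_1$ consists of the first $\beta_1$ sheet-columns, $B_2$ of the next $\beta_2$, etc. Its ordered content is the ordered type $\mathrm{ocon}(B)=k^\beta$, $\mathrm{sgn}(B)=(-1)^{l-1}$, and $\mathcal{L}(B)=|B_l|=k\beta_l$. A wrapping of $d^r$ is a $k$-wrapping for some $k\mid d$ (wrappings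 for different $k$ are regarded as different). **Constant wrapping block tabloids.** A constant wrapping block tabloid $T$ of shape $\sigma=d_1^{r_1}\cdots d_k^{r_k}$ and content $\tau$ is a list $(B^{(1)},\ldots,B^{(k)})$ where $B^{(i)}$ is a wrapping of $d_i^{r_i}$ and the multiset union of the blocks of $\mathrm{psort}(\mathrm{ocon}(B^{(i)}))$, $1\le i\le k$, equals $\tau$. Set $\mathrm{sgn}(T)=(-1)^{\ell(\tau)-\ell(\sigma)}$ and $\mathrm{wt}(T)=\prod_{i=1}^k\mathcal{L}(B^{(i)})$. *)

theory Defs
  imports Complex_Main "HOL-Library.Multiset"
begin

section \<open>Formal power series in arbitrarily many variables\<close>

text \<open>A monomial in the variables \<^typ>\<open>'v\<close> is a finite multiset of variables, so the product of
  monomials is multiset union; a formal power series is an arbitrary function from monomials to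
  coefficients.\<close>

typedef ('v, 'a) mfps = "UNIV :: ('v multiset \<Rightarrow> 'a) set"
  morphisms mfps_coeff Abs_mfps by simp

lemma mfps_coeff_Abs [simp]: "mfps_coeff (Abs_mfps f) m = f m"
  by (simp add: Abs_mfps_inverse)

lemma mfps_eqI: "(\<And>m. mfps_coeff f m = mfps_coeff g m) \<Longrightarrow> f = g"
  by (metis ext mfps_coeff_inject)

lemma finite_submultisets [simp]: "finite {a. a \<subseteq># (m :: 'v multiset)}"
proof (induction m)
  case (add x m)
  have "a \<in> {a. a \<subseteq># m} \<union> add_mset x ` {a. a \<subseteq># m}" if "a \<subseteq># add_mset x m" for a
  proof (cases "x \<in># a")
    case True
    then obtain b where "a = add_mset x b" by (metis insert_DiffM)
    with that show ?thesis by auto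
  next
    case False
    then have "count a x = 0" by (simp add: not_in_iff)
    with that have "a \<subseteq># m"
      by (metis count_add_mset le0 subseteq_mset_def)
    then show ?thesis by simp
  qed
  then have "{a. a \<subseteq># add_mset x m} \<subseteq> {a. a \<subseteq># m} \<union> add_mset x ` {a. a \<subseteq># m}" by auto
  with add.IH show ?case by (meson finite_UnI finite_imageI finite_subset)
qed simp

instantiation mfps :: (type, comm_ring_1) comm_ring_1
begin

definition "0 = Abs_mfps (\<lambda>_. 0)"
definition "1 = Abs_mfps (\<lambda>m. if m = {#} then 1 else 0)"
definition "f + g = Abs_mfps (\<lambda>m. mfps_coeff f m + mfps_coeff g m)"
definition "f - g = Abs_mfps (\<lambda>m. mfps_coeff f m - mfps_coeff g m)"
definition "- f = Abs_mfps (\<lambda>m. - mfps_coeff f m)"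
definition "f * g = Abs_mfps (\<lambda>m. \<Sum>a | a \<subseteq># m. mfps_coeff f a * mfps_coeff g (m - a))"

instance
proof
  fix f g h :: "('a, 'b) mfps"
  show "f * g * h = f * (g * h)"
  proof (rule mfps_eqI)
    fix m
    let ?F = "\<lambda>a b. mfps_coeff f b * mfps_coeff g (a - b) * mfps_coeff h (m - a)"
    have "mfps_coeff (f * g * h) m = (\<Sum>a | a \<subseteq># m. \<Sum>b | b \<subseteq># a. ?F a b)"
      by (simp add: times_mfps_def sum_distrib_right)
    also have "\<dots> = (\<Sum>(a, b) \<in> (SIGMA a:{a. a \<subseteq># m}. {b. b \<subseteq># a}). ?F a b)"
      by (rule sum.Sigma) auto
    also have "\<dots> = (\<Sum>(b, c) \<in> (SIGMA b:{b. b \<subseteq># m}. {c. c \<subseteq># m - b}).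
        mfps_coeff f b * (mfps_coeff g c * mfps_coeff h (m - b - c)))"
      by (rule sum.reindex_bij_witness[where i = "\<lambda>(b, c). (b + c, b)" and j = "\<lambda>(a, b). (b, a - b)"])
        (auto simp: mult.assoc subset_mset.le_diff_conv2 add.commute
          intro: subset_mset.trans)
    also have "\<dots> = (\<Sum>b | b \<subseteq># m. \<Sum>c | c \<subseteq># m - b.
        mfps_coeff f b * (mfps_coeff g c * mfps_coeff h (m - b - c)))"
      by (rule sum.Sigma[symmetric]) auto
    also have "\<dots> = mfps_coeff (f * (g * h)) m"
      by (simp add: times_mfps_def sum_distrib_left)
    finally show "mfps_coeff (f * g * h) m = mfps_coeff (f * (g * h)) m" .
  qed
  show "f * g = g * f"
  proof (rule mfps_eqI)
    fix m
    have *: "m - (m - a) = a" if "a \<subseteq># m" for a :: "'a multiset"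
      using that by (auto simp: multiset_eq_iff subseteq_mset_def)
    show "mfps_coeff (f * g) m = mfps_coeff (g * f) m"
      unfolding times_mfps_def mfps_coeff_Abs
      by (rule sum.reindex_bij_witness[where i = "\<lambda>a. m - a" and j = "\<lambda>a. m - a"])
        (auto simp: * mult.commute)
  qed
  show "1 * f = f"
  proof (rule mfps_eqI)
    fix m
    have "mfps_coeff (1 * f) m = (\<Sum>a | a \<subseteq># m. if a = {#} then mfps_coeff f m else 0)"
      unfolding times_mfps_def one_mfps_def mfps_coeff_Abs by (rule sum.cong) auto
    then show "mfps_coeff (1 * f) m = mfps_coeff f m" by simp
  qed
  show "(f + g) * h = f * h + g * h"
    by (rule mfps_eqI) (simp add: times_mfps_def plus_mfps_def distrib_right sum.distrib)
  have "mfps_coeff (0 :: ('a, 'b) mfps) {#} \<noteq> mfps_coeff (1 :: ('a, 'b) mfps) {#}"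
    by (simp add: zero_mfps_def one_mfps_def)
  then show "(0 :: ('a, 'b) mfps) \<noteq> 1" by auto
qed (rule mfps_eqI, simp add: zero_mfps_def plus_mfps_def minus_mfps_def uminus_mfps_def add_ac)+

end

definition mfps_scale :: "'a :: comm_ring_1 \<Rightarrow> ('v, 'a) mfps \<Rightarrow> ('v, 'a) mfps" where
  "mfps_scale c f = Abs_mfps (\<lambda>m. c * mfps_coeff f m)"

interpretation mfps: vector_space "mfps_scale :: 'a :: field \<Rightarrow> ('v, 'a) mfps \<Rightarrow> ('v, 'a) mfps"
  by unfold_locales
    (rule mfps_eqI, simp add: mfps_scale_def plus_mfps_def algebra_simps)+

text \<open>Complete homogeneous and power sum symmetric functions in the variables from \<^term>\<open>V\<close>;
  the latter is only meaningful for \<^term>\<open>e \<ge> 1\<close> (for infinite \<^term>\<open>V\<close> the sum of the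
  \<^term>\<open>e\<close>-th powers is a formal series, given here by its coefficients).\<close>

definition hsym :: "'v set \<Rightarrow> nat \<Rightarrow> ('v, 'a :: comm_ring_1) mfps" where
  "hsym V r = Abs_mfps (\<lambda>m. if size m = r \<and> set_mset m \<subseteq> V then 1 else 0)"

definition psum :: "'v set \<Rightarrow> nat \<Rightarrow> ('v, 'a :: comm_ring_1) mfps" where
  "psum V e = Abs_mfps (\<lambda>m. if \<exists>v\<in>V. m = replicate_mset e v then 1 else 0)"

text \<open>The substitution replacing every variable by its \<^term>\<open>r\<close>-th power, for \<^term>\<open>r \<ge> 1\<close>: it
  turns the monomial \<^term>\<open>m\<close> into \<^term>\<open>repeat_mset r m\<close>, so the sum below has at most one term.\<close>

definition power_subst :: "nat \<Rightarrow> ('v, 'a :: comm_ring_1) mfps \<Rightarrow> ('v, 'a) mfps" where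
  "power_subst r f = Abs_mfps (\<lambda>m. \<Sum>m' | repeat_mset r m' = m. mfps_coeff f m')"


section \<open>Types\<close>

text \<open>An ordered type \<^term>\<open>\<delta>\<close> is a function on indices \<^term>\<open>i \<ge> 1\<close>, extended by the empty
  composition at \<^term>\<open>0::nat\<close>. A block \<open>d\<^sup>r\<close> is the pair \<^term>\<open>(d, r)\<close>.\<close>

type_synonym otype = "nat \<Rightarrow> nat list"
type_synonym tblock = "nat \<times> nat"

definition composition :: "nat list \<Rightarrow> bool" where
  "composition \<beta> \<longleftrightarrow> (\<forall>b\<in>set \<beta>. b \<ge> 1)"

abbreviation area :: "nat list \<Rightarrow> nat" where
  "area \<equiv> sum_list"

definition ordered_type :: "nat \<Rightarrow> otype \<Rightarrow> bool" where
  "ordered_type n \<delta> \<longleftrightarrow> \<delta> 0 = [] \<and> (\<forall>i. composition (\<delta> i)) \<and> finite {i. \<delta> i \<noteq> []} \<and>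
     (\<Sum>i | \<delta> i \<noteq> []. i * area (\<delta> i)) = n"

definition is_type :: "nat \<Rightarrow> otype \<Rightarrow> bool" where
  "is_type n \<tau> \<longleftrightarrow> ordered_type n \<tau> \<and> (\<forall>i. sorted_wrt (\<ge>) (\<tau> i))"

definition tlength :: "otype \<Rightarrow> nat" where
  "tlength \<delta> = (\<Sum>i | \<delta> i \<noteq> []. length (\<delta> i))"

definition psort :: "otype \<Rightarrow> otype" where
  "psort \<delta> = (\<lambda>i. rev (sort (\<delta> i)))"

definition blocks :: "otype \<Rightarrow> tblock multiset" where
  "blocks \<tau> = (\<Sum>d | \<tau> d \<noteq> []. image_mset (Pair d) (mset (\<tau> d)))"

definition otype_single :: "nat \<Rightarrow> nat list \<Rightarrow> otype" where
  "otype_single k \<beta> = (\<lambda>i. if i = k then \<beta> else [])"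


section \<open>Polysymmetric functions\<close>

text \<open>The variable \<open>x\<^sub>i\<^sub>j\<close> is the pair \<^term>\<open>(i, j)\<close> with \<^term>\<open>i \<ge> 1\<close> and \<^term>\<open>j \<ge> 1\<close>.\<close>

type_synonym pseries = "(nat \<times> nat, rat) mfps"

definition xvars :: "nat \<Rightarrow> (nat \<times> nat) set" where
  "xvars i = {(i, j) | j. j \<ge> 1}"

definition htens :: "otype \<Rightarrow> pseries" where
  "htens \<delta> = (\<Prod>i | \<delta> i \<noteq> []. \<Prod>b\<leftarrow>\<delta> i. hsym (xvars i) b)"

definition polyP :: "nat \<Rightarrow> pseries" where
  "polyP d = (\<Sum>k | k dvd d. of_nat k * psum (xvars k) (d div k))"

definition polyP_block :: "tblock \<Rightarrow> pseries" where
  "polyP_block = (\<lambda>(d, r). power_subst r (polyP d))"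

definition polyP_type :: "otype \<Rightarrow> pseries" where
  "polyP_type \<sigma> = (\<Prod>b\<in>#blocks \<sigma>. polyP_block b)"

text \<open>The coefficient of \<^term>\<open>htens \<tau>\<close> in the expansion of \<^term>\<open>f\<close> in the basis of the
  degree \<^term>\<open>n\<close> polysymmetric functions formed by the \<^const>\<open>htens\<close> of the types of
  \<^term>\<open>n\<close>. Where this family is dependent, or does not span \<^term>\<open>f\<close>, the value would be
  \<^term>\<open>0::rat\<close>.\<close>

definition htens_coeff :: "nat \<Rightarrow> pseries \<Rightarrow> otype \<Rightarrow> rat" where
  "htens_coeff n f \<tau> = mfps.representation (htens ` {\<rho>. is_type n \<rho>}) f (htens \<tau>)"


section \<open>Wrappings and constant wrapping block tabloids\<close>

text \<open>The boxes of \<open>d\<^sup>r\<close> are the pairs (row, column) in \<^term>\<open>{0..<d} \<times> {0..<r}\<close>. The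
  \<^term>\<open>m\<close>-th sheet-column in reading order (counted from \<^term>\<open>0::nat\<close>) is column
  \<^term>\<open>m mod r\<close> of sheet \<^term>\<open>m div r\<close>.\<close>

definition sheet_column :: "nat \<Rightarrow> nat \<Rightarrow> nat \<Rightarrow> (nat \<times> nat) set" where
  "sheet_column k r m = {k * (m div r)..<k * (m div r + 1)} \<times> {m mod r}"

text \<open>A wrapping carries its \<^term>\<open>k\<close>, so that wrappings for different \<^term>\<open>k\<close> are different.\<close>

type_synonym wrapping = "nat \<times> (nat \<times> nat) set list"

definition kwrapping :: "nat \<Rightarrow> nat \<Rightarrow> nat list \<Rightarrow> wrapping" where
  "kwrapping k r \<beta> = (k, map (\<lambda>i. \<Union>m\<in>{area (take i \<beta>)..<area (take (Suc i) \<beta>)}. sheet_column k r m)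
     [0..<length \<beta>])"

definition wrappings :: "tblock \<Rightarrow> wrapping set" where
  "wrappings = (\<lambda>(d, r). {kwrapping k r \<beta> | k \<beta>. k dvd d \<and> composition \<beta> \<and> area \<beta> = d * r div k})"

text \<open>The content of a wrapping is read off the sizes of its parts, see \<open>ocon_kwrapping\<close> below.\<close>

definition ocon :: "wrapping \<Rightarrow> otype" where
  "ocon = (\<lambda>(k, B). otype_single k (map (\<lambda>b. card b div k) B))"

definition lastsize :: "wrapping \<Rightarrow> nat" where
  "lastsize = (\<lambda>(k, B). card (last B))"

lemma card_kwrapping_part:
  assumes "k \<ge> 1" "r \<ge> 1"
  shows "card (\<Union>m\<in>{a..<b}. sheet_column k r m) = k * (b - a)"
proof -
  have disj: "sheet_column k r m \<inter> sheet_column k r m' = {}" if "m \<noteq> m'" for m m'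
  proof (rule ccontr)
    assume "sheet_column k r m \<inter> sheet_column k r m' \<noteq> {}"
    then obtain x where x: "k * (m div r) \<le> x" "x < k * (m div r + 1)"
        "k * (m' div r) \<le> x" "x < k * (m' div r + 1)" and md: "m mod r = m' mod r"
      by (auto simp: sheet_column_def)
    have "x div k = m div r" "x div k = m' div r"
      using x by (auto intro!: div_nat_eqI simp: algebra_simps)
    with md have "m = m'" by (metis div_mult_mod_eq)
    with that show False by simp
  qed
  have "card (\<Union>m\<in>{a..<b}. sheet_column k r m) = (\<Sum>m\<in>{a..<b}. card (sheet_column k r m))"
    by (rule card_UN_disjoint) (use disj in \<open>auto simp: sheet_column_def\<close>)
  also have "\<dots> = (\<Sum>m\<in>{a..<b}. k)"
    by (simp add: sheet_column_def card_cartesian_product)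
  finally show ?thesis by simp
qed

lemma ocon_kwrapping:
  assumes "k \<ge> 1" "r \<ge> 1"
  shows "ocon (kwrapping k r \<beta>) = otype_single k \<beta>"
proof -
  have "map (\<lambda>i. area (take (Suc i) \<beta>) - area (take i \<beta>)) [0..<length \<beta>] = \<beta>"
    by (rule nth_equalityI) (auto simp: take_Suc_conv_app_nth)
  then show ?thesis
    using assms by (simp add: ocon_def kwrapping_def card_kwrapping_part comp_def)
qed

lemma lastsize_kwrapping:
  assumes "k \<ge> 1" "r \<ge> 1" "\<beta> \<noteq> []"
  shows "lastsize (kwrapping k r \<beta>) = k * last \<beta>"
proof -
  obtain \<gamma> b where "\<beta> = \<gamma> @ [b]" using assms(3) by (metis rev_exhaust)
  then show ?thesis
    using assms(1,2) by (simp add: lastsize_def kwrapping_def card_kwrapping_part)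
qed

lemma kwrapping_covers:
  assumes "k dvd d" "d \<ge> 1" "r \<ge> 1" "area \<beta> = d * r div k"
  shows "\<Union> (set (snd (kwrapping k r \<beta>))) = {0..<d} \<times> {0..<r}"
proof -
  obtain q where d: "d = k * q" using assms(1) by blast
  with assms have k: "k \<ge> 1" and a: "area \<beta> = q * r" by (auto simp: mult.assoc)
  have 1: "\<exists>i<length \<beta>. area (take i \<beta>) \<le> m \<and> m < area (take (Suc i) \<beta>)" if "m < area \<beta>" for m
    using that
  proof (induction \<beta> arbitrary: m)
    case (Cons b \<beta>)
    show ?case
    proof (cases "m < b")
      case False
      with Cons.prems have "m - b < area \<beta>" by auto
      from Cons.IH[OF this] obtain i where "i < length \<beta>"
          "area (take i \<beta>) \<le> m - b" "m - b < area (take (Suc i) \<beta>)" by blast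
      with False show ?thesis by (intro exI[of _ "Suc i"]) auto
    qed (auto intro!: exI[of _ 0])
  qed simp
  have 2: "m < area \<beta>" if "m < area (take i \<beta>)" for i m
    using that by (metis append_take_drop_id sum_list_append trans_less_add1)
  have 3: "(\<Union>i\<in>{0..<length \<beta>}. {area (take i \<beta>)..<area (take (Suc i) \<beta>)}) = {..<q * r}"
    (is "?U = _")
  proof (intro equalityI subsetI)
    fix m assume "m \<in> ?U"
    then obtain i where "m < area (take (Suc i) \<beta>)" by auto
    from 2[OF this] show "m \<in> {..<q * r}" by (simp add: a)
  next
    fix m assume "m \<in> {..<q * r}"
    with 1[of m] obtain i where "i < length \<beta>" "area (take i \<beta>) \<le> m" "m < area (take (Suc i) \<beta>)"
      unfolding a by blast
    then show "m \<in> ?U" by (intro UN_I[of i]) simp_all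
  qed
  have "\<Union> (set (snd (kwrapping k r \<beta>))) =
      (\<Union>m\<in>(\<Union>i\<in>{0..<length \<beta>}. {area (take i \<beta>)..<area (take (Suc i) \<beta>)}). sheet_column k r m)"
    by (simp add: kwrapping_def)
  also have "\<dots> = (\<Union>m\<in>{..<q * r}. sheet_column k r m)"
    unfolding 3 ..
  also have "\<dots> = {0..<d} \<times> {0..<r}"
  proof (intro equalityI subsetI)
    fix x assume "x \<in> (\<Union>m\<in>{..<q * r}. sheet_column k r m)"
    then obtain m where m: "m < q * r" "x \<in> sheet_column k r m" by auto
    then have "m div r + 1 \<le> q" by (simp add: less_mult_imp_div_less Suc_leI)
    then have "k * (m div r + 1) \<le> d" unfolding d by (rule mult_le_mono2)
    with m assms(3) show "x \<in> {0..<d} \<times> {0..<r}" by (auto simp: sheet_column_def)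
  next
    fix x assume "x \<in> {0..<d} \<times> {0..<r}"
    then obtain i j where x: "x = (i, j)" "i < d" "j < r" by auto
    define m where "m = (i div k) * r + j"
    have *: "i div k < q" using x d by (simp add: less_mult_imp_div_less mult.commute)
    have "m < (i div k + 1) * r" using x by (simp add: m_def)
    also have "\<dots> \<le> q * r" using * by (intro mult_le_mono1) simp
    finally have "m < q * r" .
    moreover have "m div r = i div k" "m mod r = j" using x by (auto simp: m_def)
    moreover have "k * (i div k) \<le> i" "i < k * (i div k + 1)"
      using k by (auto simp: algebra_simps dividend_less_times_div)
    ultimately show "x \<in> (\<Union>m\<in>{..<q * r}. sheet_column k r m)"
      by (auto simp: x sheet_column_def intro!: bexI[of _ m])
  qed
  finally show ?thesis .
qed

text \<open>The shape is given as a list of its blocks.\<close>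

definition cwbt :: "tblock list \<Rightarrow> otype \<Rightarrow> wrapping list set" where
  "cwbt bs \<tau> = {T. list_all2 (\<lambda>B b. B \<in> wrappings b) T bs \<and>
     (\<Sum>B\<leftarrow>T. blocks (psort (ocon B))) = blocks \<tau>}"

text \<open>The sign of a tabloid depends only on its shape and content. The exponent may be negative for
  unrelated types, hence \<^const>\<open>power_int\<close>.\<close>

definition cwbt_sgn :: "otype \<Rightarrow> otype \<Rightarrow> rat" where
  "cwbt_sgn \<sigma> \<tau> = (-1) powi (int (tlength \<tau>) - int (tlength \<sigma>))"

definition cwbt_wt :: "wrapping list \<Rightarrow> nat" where
  "cwbt_wt T = (\<Prod>B\<leftarrow>T. lastsize B)"

end

theory Submission
  imports Defs
begin

text \<open>Newton's identities give \<open>p\<^sub>m = \<Sum>\<beta>. (-1)\<^bsup>l(\<beta>)-1\<^esup> last(\<beta>) h\<^sub>\<beta>\<close> over the compositions \<open>\<beta>\<close> of \<open>m\<close>.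
  Since \<open>P\<close> of the block \<open>d\<^sup>r\<close> is the sum over \<open>k dvd d\<close> of \<open>k\<close> times the power sum of degree \<open>dr/k\<close>
  in the variables \<open>x\<^sub>k\<^sub>1, x\<^sub>k\<^sub>2, \<dots>\<close>, it is a sum over the wrappings of \<open>d\<^sup>r\<close>, and multiplying out gives
  the sum over tabloids. It remains that the \<^const>\<open>htens\<close> are linearly independent: they span
  the products of power sums, which are as many and are independent by a triangularity argument.\<close>

section \<open>Coefficients, scalar multiples and the substitution of r-th powers\<close>

lemma mfps_coeff_zero [simp]: "mfps_coeff 0 m = 0"
  by (simp add: zero_mfps_def)

lemma mfps_coeff_add [simp]: "mfps_coeff (f + g) m = mfps_coeff f m + mfps_coeff g m"
  by (simp add: plus_mfps_def)

lemma mfps_coeff_scale [simp]: "mfps_coeff (mfps_scale c f) m = c * mfps_coeff f m"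
  by (simp add: mfps_scale_def)

lemma mfps_coeff_mult:
  "mfps_coeff (f * g) m = (\<Sum>a | a \<subseteq># m. mfps_coeff f a * mfps_coeff g (m - a))"
  by (simp add: times_mfps_def)

lemma mfps_coeff_sum: "mfps_coeff (\<Sum>x\<in>A. f x) m = (\<Sum>x\<in>A. mfps_coeff (f x) m)"
  by (induction A rule: infinite_finite_induct) auto

lemma mfps_scale_mult:
  "mfps_scale c f * mfps_scale d g = mfps_scale (c * d) (f * g)"
  by (rule mfps_eqI, unfold mfps_coeff_mult mfps_coeff_scale)
    (simp only: sum_distrib_left mult_ac)

lemma mfps_scale_mult_left: "mfps_scale c f * g = mfps_scale c (f * g)"
  by (rule mfps_eqI, unfold mfps_coeff_mult mfps_coeff_scale)
    (simp only: sum_distrib_left mult_ac)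

lemma mfps_scale_mult_right: "f * mfps_scale c g = mfps_scale c (f * g)"
  by (rule mfps_eqI, unfold mfps_coeff_mult mfps_coeff_scale)
    (simp only: sum_distrib_left mult_ac)

lemma of_nat_mult_mfps:
  "of_nat k * f = mfps_scale (of_nat k :: 'a :: field) (f :: ('v, 'a) mfps)"
  by (induction k) (simp_all add: algebra_simps)

lemma power_subst_add: 
  "power_subst r (f + g) = power_subst r f + power_subst r g"
  by (rule mfps_eqI) (simp add: power_subst_def sum.distrib)

lemma power_subst_zero [simp]: "power_subst r 0 = 0"
  by (rule mfps_eqI) (simp add: power_subst_def)

lemma power_subst_sum: "power_subst r (\<Sum>x\<in>A. f x) = (\<Sum>x\<in>A. power_subst r (f x))"
  by (induction A rule: infinite_finite_induct) (auto simp: power_subst_add)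

lemma power_subst_scale: "power_subst r (mfps_scale c f) = mfps_scale c (power_subst r f)"
  by (rule mfps_eqI) (simp add: power_subst_def sum_distrib_left)

text \<open>For r >= 1, \<open>repeat_mset r\<close> is injective, so at most one monomial
  contributes to each coefficient; it sends v^e to v^(r*e).\<close>

lemma power_subst_psum:
  assumes "r \<ge> 1"
  shows "power_subst r (psum V e) = psum V (r * e)"
proof (rule mfps_eqI)
  fix m :: "'a multiset"
  have inj: "a = b" if "repeat_mset r a = repeat_mset r b" for a b :: "'a multiset"
    using that assms by (auto simp: multiset_eq_iff)
  have rep: "replicate_mset (r * e) v = repeat_mset r (replicate_mset e v)" for v :: 'a
    by (rule multiset_eqI) simp
  show "mfps_coeff (power_subst r (psum V e) :: ('a, 'b) mfps) m = mfps_coeff (psum V (r * e)) m"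
  proof (cases "\<exists>m'. repeat_mset r m' = m")
    case True
    then obtain m' where m': "m = repeat_mset r m'" by blast
    then have "{m'. repeat_mset r m' = m} = {m'}" using inj by auto
    moreover have "m' = replicate_mset e v \<longleftrightarrow> m = replicate_mset (r * e) v" for v
      using inj[of m' "replicate_mset e v"] unfolding m' rep by blast
    ultimately show ?thesis by (simp add: power_subst_def psum_def)
  next
    case False
    then have "m \<noteq> replicate_mset (r * e) v" for v
      unfolding rep by blast
    with False show ?thesis by (simp add: power_subst_def psum_def)
  qed
qed


section \<open>Power sums in terms of complete homogeneous symmetric functions\<close>

text \<open>Only divisors v^i of m with v in V contribute, and each cofactor has the same
  \<open>hsym\<close> coefficient, 0 or 1. Since i >= 1, different v give different divisors, so
  counting the v suffices.\<close>

lemma mfps_coeff_psum_mult_hsym: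
  assumes "i \<ge> 1"
  shows "mfps_coeff (psum V i * hsym V j :: ('v, 'a :: comm_ring_1) mfps) m =
    (if size m = i + j \<and> set_mset m \<subseteq> V then of_nat (card {v \<in> V. i \<le> count m v}) else 0)"
proof -
  let ?A = "{v \<in> V. i \<le> count m v}"
  let ?c = "if size m = i + j \<and> set_mset m \<subseteq> V then 1 else 0 :: 'a"
  have inj: "inj_on (replicate_mset i) ?A"
    using assms by (auto simp: inj_on_def replicate_mset_eq_iff)
  have "mfps_coeff (psum V i * hsym V j :: ('v, 'a) mfps) m =
      (\<Sum>a\<in>replicate_mset i ` ?A. mfps_coeff (hsym V j) (m - a))"
    unfolding mfps_coeff_mult
    by (rule sum.mono_neutral_cong_right)
      (auto simp: psum_def count_le_replicate_mset_subset_eq)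
  also have "\<dots> = (\<Sum>v\<in>?A. mfps_coeff (hsym V j) (m - replicate_mset i v))"
    by (simp add: sum.reindex inj)
  also have "\<dots> = (\<Sum>v\<in>?A. ?c)"
  proof (rule sum.cong)
    fix v assume v: "v \<in> ?A"
    then have sub: "replicate_mset i v \<subseteq># m" by (simp add: count_le_replicate_mset_subset_eq)
    then obtain m' where m': "m = replicate_mset i v + m'" by (auto simp: subset_mset.le_iff_add)
    show "mfps_coeff (hsym V j) (m - replicate_mset i v) = ?c"
      using v by (auto simp: m' hsym_def split: if_splits)
  qed simp
  also have "\<dots> = of_nat (card ?A) * ?c" by simp
  finally show ?thesis by simp
qed

text \<open>Compare coefficients at M: both sides count the pairs (i, v) with 1 <= i <=
  \<open>count M v\<close>. Each v occurs in \<open>count M v\<close> of them, which adds up to the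
  degree of M.\<close>

lemma newton_identity:
  "(\<Sum>i=1..m. psum V i * hsym V (m - i)) = (of_nat m * hsym V m :: ('v, 'a :: field) mfps)"
proof (rule mfps_eqI)
  fix M :: "'v multiset"
  have *: "(\<Sum>i=1..m. card {v \<in> V. i \<le> count M v}) = m" if M: "size M = m" "set_mset M \<subseteq> V"
  proof -
    have "(\<Sum>i=1..m. card {v \<in> V. i \<le> count M v}) =
        (\<Sum>i=1..m. card {v \<in> set_mset M. i \<le> count M v})"
      using M(2) by (intro sum.cong arg_cong[where f = card]) (auto simp flip: count_greater_zero_iff)
    also have "\<dots> = (\<Sum>i=1..m. \<Sum>v\<in>set_mset M. if i \<le> count M v then 1 else 0)"
      by (simp add: sum.If_cases Int_def)
    also have "\<dots> = (\<Sum>v\<in>set_mset M. \<Sum>i=1..m. if i \<le> count M v then 1 else 0)"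
      by (rule sum.swap)
    also have "\<dots> = (\<Sum>v\<in>set_mset M. count M v)"
    proof (rule sum.cong)
      fix v
      have "count M v \<le> m" using M(1) count_le_size by metis
      then have "{1..m} \<inter> {i. i \<le> count M v} = {1..count M v}" by auto
      then show "(\<Sum>i=1..m. if i \<le> count M v then 1 else 0) = count M v"
        by (simp add: sum.If_cases)
    qed simp
    finally show ?thesis by (simp add: M(1) flip: size_multiset_overloaded_eq)
  qed
  have "mfps_coeff (\<Sum>i=1..m. psum V i * hsym V (m - i) :: ('v, 'a) mfps) M =
      (if size M = m \<and> set_mset M \<subseteq> V then of_nat (\<Sum>i=1..m. card {v \<in> V. i \<le> count M v}) else 0)"
    by (cases "size M = m"; cases "set_mset M \<subseteq> V"; simp add: mfps_coeff_sum mfps_coeff_psum_mult_hsym)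
  then show "mfps_coeff (\<Sum>i=1..m. psum V i * hsym V (m - i) :: ('v, 'a) mfps) M =
      mfps_coeff (of_nat m * hsym V m) M"
    using * by (simp add: of_nat_mult_mfps hsym_def)
qed

section \<open>Compositions and the solution of Newton's recursion\<close>

definition compositions :: "nat \<Rightarrow> nat list set" where
  "compositions m = {\<beta>. composition \<beta> \<and> area \<beta> = m}"

text \<open>Splits off the first part i. The case i = m stands apart so that every other remainder
  is nonempty and has the same last part as the whole composition.\<close>

lemma compositions_rec:
  assumes "m \<ge> 1"
  shows "compositions m = insert [m] (\<Union>i\<in>{1..<m}. (#) i ` compositions (m - i))" (is "_ = ?R")
proof (intro equalityI subsetI)
  fix \<beta> assume b: "\<beta> \<in> compositions m"
  with assms obtain i \<gamma> where \<beta>: "\<beta> = i # \<gamma>" by (cases \<beta>) (auto simp: compositions_def)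
  show "\<beta> \<in> ?R"
  proof (cases "\<gamma> = []")
    case False
    then obtain j \<gamma>' where "\<gamma> = j # \<gamma>'" by (cases \<gamma>) auto
    with b have "i \<in> {1..<m}" "\<gamma> \<in> compositions (m - i)"
      by (auto simp: \<beta> compositions_def composition_def)
    then show ?thesis by (auto simp: \<beta>)
  qed (use b in \<open>auto simp: \<beta> compositions_def\<close>)
qed (use assms in \<open>auto simp: compositions_def composition_def\<close>)

lemma compositions_nonempty: "m \<ge> 1 \<Longrightarrow> \<beta> \<in> compositions m \<Longrightarrow> \<beta> \<noteq> []"
  by (auto simp: compositions_def)

lemma compositions_0 [simp]: "compositions 0 = {[]}"
proof -
  have "\<beta> = []" if "composition \<beta>" "area \<beta> = 0" for \<beta>
    using that by (cases \<beta>) (auto simp: composition_def)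
  then show ?thesis by (auto simp: compositions_def composition_def)
qed

lemma finite_compositions [simp]: "finite (compositions m)"
proof (induction m rule: less_induct)
  case (less m)
  show ?case
  proof (cases "m = 0")
    case False
    then show ?thesis using less by (subst compositions_rec) auto
  qed simp
qed

lemma sum_compositions_rec:
  assumes "m \<ge> 1"
  shows "(\<Sum>\<beta>\<in>compositions m. f \<beta>) =
    f [m] + (\<Sum>i\<in>{1..<m}. \<Sum>\<beta>\<in>compositions (m - i). f (i # \<beta>))"
proof -
  let ?U = "\<Union>i\<in>{1..<m}. (#) i ` compositions (m - i)"
  have "[m] \<notin> ?U" by (auto simp: compositions_def)
  moreover have "(\<Sum>\<beta>\<in>?U. f \<beta>) = (\<Sum>i\<in>{1..<m}. \<Sum>\<beta>\<in>(#) i ` compositions (m - i). f \<beta>)"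
    by (rule sum.UNION_disjoint) auto
  ultimately show ?thesis
    by (subst compositions_rec[OF assms]) (simp add: sum.reindex)
qed

text \<open>Sign times last part; the exponent l + 1 has the parity of l - 1 and avoids truncated
  subtraction.\<close>

definition hcoeff :: "nat list \<Rightarrow> rat" where
  "hcoeff \<beta> = (-1) ^ (length \<beta> + 1) * of_nat (last \<beta>)"

text \<open>Newton's identity reads p_m = m h_m - (sum over 0 < i < m of h_i p_(m-i)). The one-part
  composition gives m h_m; prepending i to a nonempty composition flips the sign and keeps the last
  part, which matches the remaining terms by induction.\<close>

lemma psum_expand:
  "m \<ge> 1 \<Longrightarrow> psum V m =
    (\<Sum>\<beta>\<in>compositions m. mfps_scale (hcoeff \<beta>) (\<Prod>b\<leftarrow>\<beta>. hsym V b) :: ('v, rat) mfps)"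
proof (induction m rule: less_induct)
  case (less m)
  let ?F = "\<lambda>\<beta>. mfps_scale (hcoeff \<beta>) (\<Prod>b\<leftarrow>\<beta>. hsym V b) :: ('v, rat) mfps"
  have h0: "hsym V 0 = (1 :: ('v, rat) mfps)"
    by (rule mfps_eqI) (auto simp: hsym_def one_mfps_def)
  have step: "(\<Sum>\<beta>\<in>compositions (m - i). ?F (i # \<beta>)) = - (hsym V i * psum V (m - i))"
    if i: "i \<in> {1..<m}" for i
  proof -
    have mi: "m - i < m" "m - i \<ge> 1" using i by auto
    have "hsym V i * psum V (m - i) = (\<Sum>\<beta>\<in>compositions (m - i). hsym V i * ?F \<beta>)"
      unfolding less.IH[OF mi] sum_distrib_left ..
    also have "\<dots> = (\<Sum>\<beta>\<in>compositions (m - i). - ?F (i # \<beta>))"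
      using compositions_nonempty[OF mi(2)]
      by (intro sum.cong) (auto simp: mfps_scale_mult_right hcoeff_def simp flip: mfps.scale_minus_left)
    finally show ?thesis by (simp add: sum_negf)
  qed
  have "(\<Sum>\<beta>\<in>compositions m. ?F \<beta>) = ?F [m] - (\<Sum>i\<in>{1..<m}. hsym V i * psum V (m - i))"
    using less.prems step by (simp add: sum_compositions_rec sum_negf)
  also have "?F [m] = (\<Sum>i=1..m. psum V i * hsym V (m - i))"
    unfolding newton_identity of_nat_mult_mfps by (simp add: hcoeff_def)
  also have "{1..m} = insert m {1..<m}" using less.prems by auto
  also have "(\<Sum>i\<in>insert m {1..<m}. psum V i * hsym V (m - i)) =
      psum V m + (\<Sum>i\<in>{1..<m}. psum V i * hsym V (m - i) :: ('v, rat) mfps)"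
    by (simp add: h0)
  also have "(\<Sum>i\<in>{1..<m}. psum V i * hsym V (m - i) :: ('v, rat) mfps) =
      (\<Sum>i\<in>{1..<m}. hsym V i * psum V (m - i))"
    by (rule sum.reindex_bij_witness[where i = "\<lambda>i. m - i" and j = "\<lambda>i. m - i"])
      (auto simp: mult.commute)
  finally show ?case by simp
qed


section \<open>Types as multisets of blocks\<close>

definition block_weight :: "tblock multiset \<Rightarrow> nat" where
  "block_weight B = (\<Sum>(d, r)\<in>#B. d * r)"

text \<open>Stands in for the set of types of n (see \<open>blocks_image_types\<close>); products of
  symmetric functions then correspond to sums of multisets.\<close>

definition block_msets :: "nat \<Rightarrow> tblock multiset set" where
  "block_msets n = {B. (\<forall>(d, r)\<in>#B. d \<ge> 1 \<and> r \<ge> 1) \<and> block_weight B = n}"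

lemma block_weight_simps [simp]:
  "block_weight {#} = 0"
  "block_weight (add_mset b B) = fst b * snd b + block_weight B"
  "block_weight (B + C) = block_weight B + block_weight C"
  by (simp_all add: block_weight_def case_prod_unfold)

lemma block_weight_Pair: "block_weight (image_mset (Pair d) (mset \<beta>)) = d * area \<beta>"
  by (induction \<beta>) (auto simp: algebra_simps)

lemma block_msets_add:
  "B \<in> block_msets a \<Longrightarrow> C \<in> block_msets b \<Longrightarrow> B + C \<in> block_msets (a + b)"
  by (auto simp: block_msets_def)

lemma block_msets_Pair:
  "d \<ge> 1 \<Longrightarrow> \<beta> \<in> compositions r \<Longrightarrow> image_mset (Pair d) (mset \<beta>) \<in> block_msets (d * r)"
  by (auto simp: block_msets_def block_weight_Pair compositions_def composition_def)

text \<open>Every block has weight at least 1, so d, r and all multiplicities are at most n; hence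
  every such multiset is contained in the single multiset \<open>?M\<close>.\<close>

lemma finite_block_msets: "finite (block_msets n)"
proof -
  let ?S = "{1..n} \<times> {1..n}"
  let ?M = "\<Sum>x\<in>?S. replicate_mset n x"
  have M: "count ?M x = (if x \<in> ?S then n else 0)" for x
    by (simp add: count_sum)
  have size: "size B \<le> block_weight B" if "\<forall>(d, r)\<in>#B. d \<ge> 1 \<and> r \<ge> 1" for B
    using that
  proof (induction B)
    case (add b B)
    then have "1 * 1 \<le> fst b * snd b" by (intro mult_le_mono) auto
    moreover have "size B \<le> block_weight B" using add by simp
    ultimately show ?case unfolding size_add_mset block_weight_simps by linarith
  qed simp
  have "B \<subseteq># ?M" if B: "B \<in> block_msets n" for B
  proof (rule mset_subset_eqI)
    fix x
    have "x \<in> ?S" if x: "x \<in># B"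
    proof -
      obtain C where C: "B = add_mset x C" using multi_member_split[OF x] by blast
      then have bounds: "fst x \<ge> 1" "snd x \<ge> 1" "fst x * snd x \<le> n"
        using B by (auto simp: block_msets_def)
      have "fst x * 1 \<le> fst x * snd x" "1 * snd x \<le> fst x * snd x"
        using bounds by (intro mult_le_mono; simp)+
      with bounds have "fst x \<le> n" "snd x \<le> n" by linarith+
      with bounds show ?thesis by (simp add: mem_Times_iff)
    qed
    moreover have "count B x \<le> n"
      using size[of B] B count_le_size[of B x] by (auto simp: block_msets_def)
    ultimately show "count B x \<le> count ?M x"
      unfolding M by (cases "x \<in># B") (auto simp: not_in_iff)
  qed
  then have "block_msets n \<subseteq> {B. B \<subseteq># ?M}" by auto
  then show ?thesis by (rule finite_subset) simp
qed

lemma filter_fst_blocks: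
  assumes "finite {i. \<delta> i \<noteq> []}"
  shows "image_mset snd (filter_mset (\<lambda>b. fst b = i) (blocks \<delta>)) = mset (\<delta> i)"
proof -
  have *: "image_mset snd (filter_mset (\<lambda>b. fst b = i) (\<Sum>d\<in>A. image_mset (Pair d) (mset (\<delta> d)))) =
      (\<Sum>d\<in>A. if d = i then mset (\<delta> d) else {#})" if "finite A" for A
    using that by induction (auto simp: filter_mset_image_mset multiset.map_comp comp_def)
  show ?thesis using assms by (simp add: blocks_def *)
qed

lemma sum_mset_sum: "(\<Sum>b\<in>#(\<Sum>i\<in>A. M i). f b) = (\<Sum>i\<in>A. \<Sum>b\<in>#M i. (f b :: 'b :: comm_monoid_add))"
  by (induction A rule: infinite_finite_induct) auto

lemma prod_mset_sum: "(\<Prod>b\<in>#(\<Sum>i\<in>A. M i). f b) = (\<Prod>i\<in>A. \<Prod>b\<in>#M i. (f b :: 'b :: comm_monoid_mult))"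
  by (induction A rule: infinite_finite_induct) auto

lemma tlength_eq_size_blocks: "tlength \<delta> = size (blocks \<delta>)"
proof -
  have "size (blocks \<delta>) = (\<Sum>b\<in>#blocks \<delta>. 1)" by simp
  also have "\<dots> = tlength \<delta>"
    unfolding blocks_def sum_mset_sum by (simp add: tlength_def)
  finally show ?thesis by simp
qed

lemma blocks_in_block_msets:
  assumes "ordered_type n \<delta>"
  shows "blocks \<delta> \<in> block_msets n"
proof -
  have "block_weight (blocks \<delta>) = (\<Sum>i | \<delta> i \<noteq> []. block_weight (image_mset (Pair i) (mset (\<delta> i))))"
    by (simp add: block_weight_def blocks_def sum_mset_sum)
  then have "block_weight (blocks \<delta>) = n"
    using assms by (simp add: ordered_type_def block_weight_Pair)
  moreover have "d \<ge> 1 \<and> r \<ge> 1" if "(d, r) \<in># blocks \<delta>" for d r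
  proof -
    have fin: "finite {i. \<delta> i \<noteq> []}" using assms by (simp add: ordered_type_def)
    have "r \<in># image_mset snd (filter_mset (\<lambda>b. fst b = d) (blocks \<delta>))"
      using that by force
    then have "r \<in> set (\<delta> d)" by (simp add: filter_fst_blocks[OF fin])
    moreover from this have "d \<noteq> 0" using assms by (cases d) (auto simp: ordered_type_def)
    ultimately show ?thesis using assms by (auto simp: ordered_type_def composition_def)
  qed
  ultimately show ?thesis by (auto simp: block_msets_def)
qed

text \<open>Surjectivity of \<open>blocks\<close>: collect the second components of the blocks with
  first component i and list them in decreasing order.\<close>

lemma block_msets_is_type:
  assumes "B \<in> block_msets n"
  shows "\<exists>\<tau>. is_type n \<tau> \<and> blocks \<tau> = B"
proof -
  define \<tau> where "\<tau> i = rev (sorted_list_of_multiset (image_mset snd (filter_mset (\<lambda>b. fst b = i) B)))" for i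
  have m: "mset (\<tau> i) = image_mset snd (filter_mset (\<lambda>b. fst b = i) B)" for i
    by (simp add: \<tau>_def)
  have s: "set (\<tau> i) = {r. (i, r) \<in># B}" for i
    by (force simp flip: set_mset_mset simp: m)
  have ne: "{i. \<tau> i \<noteq> []} = fst ` set_mset B"
    by (force simp flip: set_empty simp: s)
  have bl: "blocks \<tau> = B"
  proof -
    have "image_mset (Pair i) (mset (\<tau> i)) = filter_mset (\<lambda>b. fst b = i) B" for i
    proof -
      have "image_mset (Pair i) (mset (\<tau> i)) =
          image_mset (\<lambda>b. (i, snd b)) (filter_mset (\<lambda>b. fst b = i) B)"
        by (simp add: m multiset.map_comp comp_def)
      also have "\<dots> = image_mset (\<lambda>b. b) (filter_mset (\<lambda>b. fst b = i) B)"
        by (rule image_mset_cong) auto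
      finally show ?thesis by simp
    qed
    then have "blocks \<tau> = (\<Sum>i\<in>fst ` set_mset B. filter_mset (\<lambda>b. fst b = i) B)"
      by (simp add: blocks_def ne)
    also have "\<dots> = B"
      by (rule multiset_eqI) (auto simp: count_sum not_in_iff image_iff)
    finally show ?thesis .
  qed
  have "\<tau> 0 = []" using assms s[of 0] by (auto simp: block_msets_def simp flip: set_empty)
  moreover have "\<forall>i. composition (\<tau> i)"
    using assms by (auto simp: composition_def s block_msets_def)
  moreover have "finite {i. \<tau> i \<noteq> []}" by (simp add: ne)
  moreover have "(\<Sum>i | \<tau> i \<noteq> []. i * area (\<tau> i)) = n"
  proof -
    have "(\<Sum>i | \<tau> i \<noteq> []. i * area (\<tau> i)) =
        (\<Sum>i | \<tau> i \<noteq> []. block_weight (image_mset (Pair i) (mset (\<tau> i))))"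
      by (simp add: block_weight_Pair)
    also have "\<dots> = block_weight (blocks \<tau>)"
      by (simp add: block_weight_def blocks_def sum_mset_sum)
    finally show ?thesis using assms bl by (simp add: block_msets_def)
  qed
  moreover have "sorted_wrt (\<ge>) (\<tau> i)" for i
    by (simp add: \<tau>_def sorted_wrt_rev)
  ultimately show ?thesis using bl by (auto simp: is_type_def ordered_type_def)
qed

lemma blocks_image_types: "blocks ` {\<tau>. is_type n \<tau>} = block_msets n"
  using blocks_in_block_msets block_msets_is_type
  by (fastforce simp: is_type_def)

section \<open>The two families of products indexed by block multisets\<close>

definition hprod :: "tblock multiset \<Rightarrow> pseries" where
  "hprod B = (\<Prod>(d, r)\<in>#B. hsym (xvars d) r)"

text \<open>An auxiliary family, different from \<open>polyP_type\<close>: the block d^r contributes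
  only the r-th power sum of the variables x_d1, x_d2, and so on.\<close>

definition pprod :: "tblock multiset \<Rightarrow> pseries" where
  "pprod B = (\<Prod>(d, r)\<in>#B. psum (xvars d) r)"

lemma htens_eq_hprod: "htens \<delta> = hprod (blocks \<delta>)"
  unfolding htens_def hprod_def blocks_def prod_mset_sum
  by (simp add: multiset.map_comp comp_def flip: prod_mset_prod_list)

lemma hprod_add [simp]: "hprod (B + C) = hprod B * hprod C"
  by (simp add: hprod_def)

lemma hprod_Pair: "hprod (image_mset (Pair d) (mset \<beta>)) = (\<Prod>b\<leftarrow>\<beta>. hsym (xvars d) b)"
  by (simp add: hprod_def multiset.map_comp comp_def flip: prod_mset_prod_list)


section \<open>Linear independence\<close>

text \<open>Excludes cancellation when a single positive contribution is exhibited in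
  \<open>pprod_coeff_pos\<close>.\<close>

lemma pprod_coeff_nonneg: "mfps_coeff (pprod B) m \<ge> 0"
proof (induction B arbitrary: m)
  case (add b B)
  then show ?case
    by (auto simp: pprod_def case_prod_unfold mfps_coeff_mult psum_def intro!: sum_nonneg)
qed (simp add: pprod_def one_mfps_def)

text \<open>A monomial of \<open>pprod B\<close> arises by picking a variable for each block of \<open>B\<close>; it has fewer
  distinct variables than \<open>B\<close> has blocks unless the picks are distinct, and then its exponents
  recover \<open>B\<close>.\<close>

lemma pprod_coeff_nonzero:
  assumes "mfps_coeff (pprod B) m \<noteq> 0" and "\<forall>(d, r)\<in>#B. r \<ge> 1"
  shows "card (set_mset m) \<le> size B \<and> (card (set_mset m) = size B \<longrightarrow>
    image_mset (\<lambda>v. (fst v, count m v)) (mset_set (set_mset m)) = B)"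
  using assms
proof (induction B arbitrary: m)
  case empty
  then show ?case by (auto simp: pprod_def one_mfps_def split: if_splits)
next
  case (add b B)
  obtain d r where b: "b = (d, r)" by (cases b)
  from add.prems have r: "r \<ge> 1" by (simp add: b)
  have "mfps_coeff (psum (xvars d) r * pprod B) m \<noteq> 0"
    using add.prems(1) by (simp add: pprod_def b)
  then obtain a where a: "a \<subseteq># m" "mfps_coeff (psum (xvars d) r :: pseries) a \<noteq> 0"
      "mfps_coeff (pprod B) (m - a) \<noteq> 0"
    unfolding mfps_coeff_mult by (metis (mono_tags, lifting) mem_Collect_eq mult_eq_0_iff sum.neutral)
  from a(2) obtain v where v: "v \<in> xvars d" "a = replicate_mset r v"
    by (auto simp: psum_def split: if_splits)
  define m' where "m' = m - a"
  have m: "m = m' + replicate_mset r v" using a(1) v(2) by (simp add: m'_def)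
  have IH: "card (set_mset m') \<le> size B" "card (set_mset m') = size B \<Longrightarrow>
      image_mset (\<lambda>v. (fst v, count m' v)) (mset_set (set_mset m')) = B"
    using add.IH[of m'] a(3) add.prems(2) by (auto simp: m'_def)
  have set: "set_mset m = insert v (set_mset m')" using r by (auto simp: m)
  show ?case
  proof (cases "v \<in># m'")
    \<comment> \<open>A repeated pick adds no new variable, so m has strictly fewer variables than
      there are blocks and the second claim is vacuous.\<close>
    case True
    then have "set_mset m = set_mset m'" using set by auto
    then show ?thesis using IH(1) by simp
  next
    case False
    then have "image_mset (\<lambda>v. (fst v, count m v)) (mset_set (set_mset m)) =
        add_mset (fst v, count m v) (image_mset (\<lambda>v. (fst v, count m v)) (mset_set (set_mset m')))"
      by (simp add: set)
    also have "image_mset (\<lambda>v. (fst v, count m v)) (mset_set (set_mset m')) =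
        image_mset (\<lambda>v. (fst v, count m' v)) (mset_set (set_mset m'))"
      using False by (intro image_mset_cong) (auto simp: m)
    also have "(fst v, count m v) = b"
      using v False by (auto simp: m b xvars_def not_in_iff)
    finally show ?thesis using IH False by (auto simp: set)
  qed
qed

text \<open>Each \<open>xvars d\<close> is infinite, so every block can pick a fresh variable; the
  resulting monomial has as many variables as \<open>B\<close> has blocks.\<close>

lemma pprod_coeff_pos:
  assumes "\<forall>(d, r)\<in>#B. r \<ge> 1"
  shows "\<exists>m. card (set_mset m) = size B \<and> mfps_coeff (pprod B) m > 0"
  using assms
proof (induction B)
  case empty
  then show ?case by (auto intro!: exI[of _ "{#}"] simp: pprod_def one_mfps_def)
next
  case (add b B)
  obtain d r where b: "b = (d, r)" by (cases b)
  from add.prems have r: "r \<ge> 1" by (simp add: b)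
  from add obtain m where m: "card (set_mset m) = size B" "mfps_coeff (pprod B) m > 0" by auto
  have "infinite (xvars d)"
  proof -
    have "xvars d = Pair d ` {1..}" by (auto simp: xvars_def)
    then show ?thesis by (simp add: finite_image_iff inj_on_def infinite_Ici)
  qed
  then obtain v where v: "v \<in> xvars d" "v \<notin># m"
    by (metis finite_set_mset finite_subset subsetI)
  let ?m = "m + replicate_mset r v"
  let ?g = "\<lambda>a. mfps_coeff (psum (xvars d) r) a * mfps_coeff (pprod B) (?m - a)"
  have "0 < ?g (replicate_mset r v)" using m(2) v(1) by (auto simp: psum_def)
  also have "\<dots> \<le> (\<Sum>a | a \<subseteq># ?m. ?g a)"
    by (rule member_le_sum) (auto simp: psum_def pprod_coeff_nonneg)
  also have "\<dots> = mfps_coeff (pprod (add_mset b B)) ?m"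
    by (simp add: pprod_def b mfps_coeff_mult)
  finally show ?case
    using r m(1) v(2) by (intro exI[of _ ?m]) auto
qed

text \<open>Take m with exactly \<open>size B\<close> distinct variables. If m occurs in
  \<open>pprod C\<close>, then C has at least that many blocks; with \<open>size C\<close> at most
  \<open>size B\<close> the sizes agree, and the exponents of m recover both C and B.\<close>

lemma pprod_triangular:
  assumes "B \<in> block_msets n"
  obtains m where "mfps_coeff (pprod B) m \<noteq> 0"
    and "\<And>C. C \<in> block_msets n \<Longrightarrow> mfps_coeff (pprod C) m \<noteq> 0 \<Longrightarrow> size C \<le> size B \<Longrightarrow> C = B"
proof -
  have pos: "\<forall>(d, r)\<in>#C. r \<ge> 1" if "C \<in> block_msets n" for C
    using that by (auto simp: block_msets_def)
  obtain m where m: "card (set_mset m) = size B" "mfps_coeff (pprod B) m > 0"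
    using pprod_coeff_pos pos[OF assms] by blast
  show ?thesis
  proof
    show nz: "mfps_coeff (pprod B) m \<noteq> 0" using m by simp
    fix C assume C: "C \<in> block_msets n" "mfps_coeff (pprod C) m \<noteq> 0" "size C \<le> size B"
    show "C = B"
      using pprod_coeff_nonzero[OF nz pos[OF assms]] pprod_coeff_nonzero[OF C(2) pos[OF C(1)]] m(1) C(3)
      by auto
  qed
qed

text \<open>Triangularity is applied to whichever of the two multisets has more blocks.\<close>

lemma pprod_inj_on: "inj_on pprod (block_msets n)"
proof (rule inj_onI)
  fix B C assume BC: "B \<in> block_msets n" "C \<in> block_msets n" "pprod B = pprod C"
  show "B = C"
  proof (cases "size C \<le> size B")
    case True
    then show ?thesis using BC by (metis pprod_triangular)
  next
    case False
    then show ?thesis using BC by (metis pprod_triangular nle_le)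
  qed
qed

text \<open>In a vanishing combination, pick B of maximal size among the indices with nonzero
  coefficient. By triangularity its monomial m meets no other term, so the coefficient of B must
  vanish.\<close>

lemma pprod_independent: "\<not> mfps.dependent (pprod ` block_msets n)"
proof
  assume "mfps.dependent (pprod ` block_msets n)"
  then obtain u where u: "\<exists>v\<in>pprod ` block_msets n. u v \<noteq> 0"
      "(\<Sum>v\<in>pprod ` block_msets n. mfps_scale (u v) v) = 0"
    using mfps.dependent_finite[OF finite_imageI[OF finite_block_msets]] by blast
  let ?S = "{B \<in> block_msets n. u (pprod B) \<noteq> 0}"
  have "finite ?S" "?S \<noteq> {}" using u(1) finite_block_msets[of n] by auto
  then have "Max (size ` ?S) \<in> size ` ?S" by (intro Max_in) auto
  then obtain B where B: "B \<in> ?S" "size B = Max (size ` ?S)" by auto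
  have max: "size C \<le> size B" if "C \<in> ?S" for C
    unfolding B(2) using \<open>finite ?S\<close> that by (intro Max_ge) auto
  from B(1) obtain m where m: "mfps_coeff (pprod B) m \<noteq> 0"
      "\<And>C. C \<in> block_msets n \<Longrightarrow> mfps_coeff (pprod C) m \<noteq> 0 \<Longrightarrow> size C \<le> size B \<Longrightarrow> C = B"
    using pprod_triangular by blast
  have "0 = mfps_coeff (\<Sum>v\<in>pprod ` block_msets n. mfps_scale (u v) v) m" by (simp add: u(2))
  also have "\<dots> = (\<Sum>C\<in>block_msets n. u (pprod C) * mfps_coeff (pprod C) m)"
    by (simp add: sum.reindex[OF pprod_inj_on] mfps_coeff_sum)
  also have "\<dots> = (\<Sum>C\<in>{B}. u (pprod C) * mfps_coeff (pprod C) m)"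
    using B(1) max m(2) by (intro sum.mono_neutral_right) (auto simp: finite_block_msets)
  finally show False using B(1) m(1) by simp
qed

text \<open>By bilinearity it suffices to multiply basis products, where block multisets add and so
  do their weights.\<close>

lemma hprod_span_mult:
  assumes "x \<in> mfps.span (hprod ` block_msets a)" "y \<in> mfps.span (hprod ` block_msets b)"
  shows "x * y \<in> mfps.span (hprod ` block_msets (a + b))"
  using assms(1)
proof (induction rule: mfps.span_induct_alt)
  case (step c x z)
  then obtain B where B: "B \<in> block_msets a" "x = hprod B" by blast
  from assms(2) have "hprod B * y \<in> mfps.span (hprod ` block_msets (a + b))"
  proof (induction rule: mfps.span_induct_alt)
    case (step c y w)
    then obtain C where "C \<in> block_msets b" "y = hprod C" by blast
    then have "hprod B * y \<in> mfps.span (hprod ` block_msets (a + b))"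
      using B(1) by (auto intro: mfps.span_base block_msets_add simp flip: hprod_add)
    with step show ?case
      by (auto simp: distrib_left mfps_scale_mult_right intro!: mfps.span_add mfps.span_scale)
  qed (simp add: mfps.span_zero)
  with step B show ?case
    by (auto simp: distrib_right mfps_scale_mult_left intro!: mfps.span_add mfps.span_scale)
qed (simp add: mfps.span_zero)

text \<open>One block at a time: \<open>psum_expand\<close> turns the factor of d^r into a
  combination of \<open>hprod\<close> of weight d * r, and the weights add under
  multiplication.\<close>

lemma pprod_in_span_hprod:
  "B \<in> block_msets n \<Longrightarrow> pprod B \<in> mfps.span (hprod ` block_msets n)"
proof (induction B arbitrary: n)
  case empty
  have "hprod {#} \<in> hprod ` block_msets 0" by (auto simp: block_msets_def)
  then show ?case using empty
    by (auto simp: block_msets_def pprod_def hprod_def intro: mfps.span_base)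
next
  case (add b B)
  obtain d r where b: "b = (d, r)" by (cases b)
  from add.prems have dr: "d \<ge> 1" "r \<ge> 1" and n: "n = d * r + block_weight B"
    and B: "B \<in> block_msets (block_weight B)"
    by (auto simp: block_msets_def b)
  have "psum (xvars d) r =
      (\<Sum>\<beta>\<in>compositions r. mfps_scale (hcoeff \<beta>) (hprod (image_mset (Pair d) (mset \<beta>))))"
    using dr(2) by (simp add: psum_expand hprod_Pair)
  also have "\<dots> \<in> mfps.span (hprod ` block_msets (d * r))"
    using dr(1) by (intro mfps.span_sum mfps.span_scale mfps.span_base imageI block_msets_Pair)
  finally have "psum (xvars d) r * pprod B \<in> mfps.span (hprod ` block_msets n)"
    unfolding n using add.IH[OF B] by (rule hprod_span_mult)
  then show ?case by (simp add: pprod_def b)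
qed

text \<open>The \<open>pprod\<close> are independent, lie in the span of the \<open>hprod\<close>, and both families have the same
  finite index set; so no \<open>hprod\<close> can be redundant.\<close>

lemma hprod_independent_inj_on:
  "\<not> mfps.dependent (hprod ` block_msets n) \<and> inj_on hprod (block_msets n)"
proof -
  let ?H = "hprod ` block_msets n" and ?P = "pprod ` block_msets n"
  obtain B where B: "B \<subseteq> ?H" "\<not> mfps.dependent B" "?H \<subseteq> mfps.span B"
    using mfps.maximal_independent_subset[of ?H] by blast
  have finB: "finite B" using B(1) finite_block_msets finite_subset by blast
  have "?P \<subseteq> mfps.span ?H" using pprod_in_span_hprod by blast
  also have "\<dots> \<subseteq> mfps.span B" using B(3) by (metis mfps.span_mono mfps.span_span)
  finally have "card ?P \<le> card B"
    using mfps.independent_span_bound[OF finB pprod_independent] by blast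
  moreover have "card ?P = card (block_msets n)" by (rule card_image[OF pprod_inj_on])
  moreover have "card ?H \<le> card (block_msets n)" by (rule card_image_le[OF finite_block_msets])
  moreover have "card B \<le> card ?H" using B(1) finite_block_msets by (intro card_mono) auto
  \<comment> \<open>The exchange bound closes the cycle |block_msets| = |P| <= |B| <= |H| <=
    |block_msets|, so equality holds throughout: B is all of H, and \<open>hprod\<close> identifies
    no two indices.\<close>
  ultimately have "card B = card ?H" "card ?H = card (block_msets n)" by auto
  then have "B = ?H" "inj_on hprod (block_msets n)"
    using B(1) finite_block_msets[of n] by (auto simp: card_subset_eq intro: eq_card_imp_inj_on)
  with B(2) show ?thesis by simp
qed


section \<open>Expansion over tabloids\<close>

definition wcontent :: "wrapping \<Rightarrow> tblock multiset" where
  "wcontent W = blocks (psort (ocon W))"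

text \<open>The sign of the wrapping times the size of its last part; as in \<open>hcoeff\<close>,
  the exponent is shifted by 2.\<close>

definition wcoeff :: "wrapping \<Rightarrow> rat" where
  "wcoeff W = (-1) ^ (size (wcontent W) + 1) * of_nat (lastsize W)"

lemma wcontent_kwrapping:
  assumes "k \<ge> 1" "r \<ge> 1"
  shows "wcontent (kwrapping k r \<beta>) = image_mset (Pair k) (mset \<beta>)"
proof -
  have "{i. psort (otype_single k \<beta>) i \<noteq> []} = (if \<beta> = [] then {} else {k})"
    by (auto simp: psort_def otype_single_def)
       (metis set_empty set_sort)+
  then show ?thesis
    using assms by (simp add: wcontent_def ocon_kwrapping blocks_def psort_def otype_single_def)
qed

text \<open>The number k is stored in the wrapping, and \<open>ocon\<close> recovers the composition
  from the sizes of the parts.\<close>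

lemma kwrapping_inj:
  assumes "k \<ge> 1" "r \<ge> 1" "kwrapping k r \<beta> = kwrapping k' r \<gamma>"
  shows "k = k' \<and> \<beta> = \<gamma>"
proof -
  have k: "k = k'" using assms(3) by (simp add: kwrapping_def)
  with assms have "otype_single k \<beta> k = otype_single k \<gamma> k" by (metis ocon_kwrapping)
  with k show ?thesis by (simp add: otype_single_def)
qed

lemma wrappings_altdef:
  "wrappings (d, r) = (\<lambda>(k, \<beta>). kwrapping k r \<beta>) `
     (SIGMA k:{k. k dvd d}. compositions (d * r div k))"
  by (auto simp: wrappings_def compositions_def)

lemma finite_wrappings: "d \<ge> 1 \<Longrightarrow> finite (wrappings (d, r))"
  unfolding wrappings_altdef by (intro finite_imageI finite_SigmaI) auto

lemma wcontent_in_block_msets: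
  assumes "d \<ge> 1" "r \<ge> 1" "W \<in> wrappings (d, r)"
  shows "wcontent W \<in> block_msets (d * r)"
proof -
  obtain k \<beta> where W: "W = kwrapping k r \<beta>" "k dvd d" "\<beta> \<in> compositions (d * r div k)"
    using assms(3) by (auto simp: wrappings_altdef)
  then have k: "k \<ge> 1" using assms(1) by (cases k) auto
  from block_msets_Pair[OF k W(3)] show ?thesis
    using k W(1,2) assms(2) by (simp add: wcontent_kwrapping)
qed

text \<open>Substituting r-th powers turns the degree d/k into dr/k, so Newton's expansion runs over
  the compositions of dr/k, that is, over the k-wrappings of d^r.\<close>

lemma polyP_block_expand:
  assumes "d \<ge> 1" "r \<ge> 1"
  shows "polyP_block (d, r) = (\<Sum>W\<in>wrappings (d, r). mfps_scale (wcoeff W) (hprod (wcontent W)))"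
proof -
  let ?F = "\<lambda>W. mfps_scale (wcoeff W) (hprod (wcontent W))"
  let ?K = "{k. k dvd d}"
  have "polyP_block (d, r) = (\<Sum>k\<in>?K. mfps_scale (of_nat k) (psum (xvars k) (r * (d div k))))"
    using assms(2)
    by (simp add: polyP_block_def polyP_def of_nat_mult_mfps power_subst_sum power_subst_scale power_subst_psum)
  also have "\<dots> = (\<Sum>k\<in>?K. \<Sum>\<beta>\<in>compositions (d * r div k). ?F (kwrapping k r \<beta>))"
  proof (rule sum.cong)
    fix k assume "k \<in> ?K"
    then have kd: "k dvd d" by simp
    then have k: "k \<ge> 1" using assms(1) by (cases k) auto
    have e: "r * (d div k) = d * r div k" using kd by (simp add: div_mult_swap mult.commute)
    have "d div k \<noteq> 0" using kd assms(1) k by (auto simp: dvd_div_eq_0_iff)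
    then have pos: "d * r div k \<ge> 1" using assms(2) by (simp flip: e)
    have "mfps_scale (of_nat k) (psum (xvars k) (r * (d div k))) =
        (\<Sum>\<beta>\<in>compositions (d * r div k).
          mfps_scale (of_nat k * hcoeff \<beta>) (hprod (image_mset (Pair k) (mset \<beta>))))"
      unfolding e psum_expand[OF pos] by (simp add: mfps.scale_sum_right hprod_Pair)
    \<comment> \<open>The factor k from \<open>polyP\<close> and the last part of the composition
      combine to k times that part, the size of the last part of the wrapping.\<close>
    also have "\<dots> = (\<Sum>\<beta>\<in>compositions (d * r div k). ?F (kwrapping k r \<beta>))"
      using k assms(2) compositions_nonempty[OF pos]
      by (intro sum.cong)
        (auto simp: wcontent_kwrapping wcoeff_def lastsize_kwrapping hcoeff_def)
    finally show "mfps_scale (of_nat k) (psum (xvars k) (r * (d div k))) =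
        (\<Sum>\<beta>\<in>compositions (d * r div k). ?F (kwrapping k r \<beta>))" .
  qed simp
  also have "\<dots> = (\<Sum>(k, \<beta>)\<in>(SIGMA k:?K. compositions (d * r div k)). ?F (kwrapping k r \<beta>))"
    using assms(1) by (intro sum.Sigma) auto
  also have "\<dots> = (\<Sum>W\<in>wrappings (d, r). ?F W)"
  proof -
    have "inj_on (\<lambda>(k, \<beta>). kwrapping k r \<beta>) (SIGMA k:?K. compositions (d * r div k))"
    proof (rule inj_onI, clarify)
      fix k \<beta> k' \<gamma> assume "k dvd d" "kwrapping k r \<beta> = kwrapping k' r \<gamma>"
      moreover from this have "k \<ge> 1" using assms(1) by (cases k) auto
      ultimately show "k = k' \<and> \<beta> = \<gamma>" using kwrapping_inj assms(2) by blast
    qed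
    then show ?thesis by (simp add: wrappings_altdef sum.reindex case_prod_unfold)
  qed
  finally show ?thesis .
qed

section \<open>Multiplying out over lists of wrappings\<close>

lemma list_all2_Cons_set:
  "{T. list_all2 P T (b # bs)} = (\<lambda>(W, T). W # T) ` ({W. P W b} \<times> {T. list_all2 P T bs})"
  by (auto simp: list_all2_Cons2)

lemma finite_list_all2:
  "(\<And>b. b \<in> set bs \<Longrightarrow> finite (A b)) \<Longrightarrow> finite {T. list_all2 (\<lambda>B b. B \<in> A b) T bs}"
  by (induction bs) (auto simp: list_all2_Cons_set)

text \<open>The general distributive law: a term of the expanded product is a list choosing one
  summand from each factor.\<close>

lemma prod_list_sum:
  fixes f :: "'b \<Rightarrow> 'c :: comm_semiring_1"
  shows "(\<And>b. b \<in> set bs \<Longrightarrow> finite (A b)) \<Longrightarrow>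
    (\<Prod>b\<leftarrow>bs. \<Sum>W\<in>A b. f W) = (\<Sum>T | list_all2 (\<lambda>B b. B \<in> A b) T bs. \<Prod>W\<leftarrow>T. f W)"
proof (induction bs)
  case (Cons b bs)
  have "inj_on (\<lambda>(W, T). W # T) (A b \<times> {T. list_all2 (\<lambda>B b. B \<in> A b) T bs})"
    by (auto simp: inj_on_def)
  then show ?case
    using Cons by (simp add: list_all2_Cons_set sum.reindex sum_product sum.cartesian_product
        case_prod_unfold)
qed simp

text \<open>Each wrapping contributes its number of parts plus 1 to the sign exponent; the ones add
  up to \<open>length T\<close>, the number of blocks of the shape.\<close>

lemma prod_list_wrappings:
  "(\<Prod>W\<leftarrow>T. mfps_scale (wcoeff W) (hprod (wcontent W))) =
    mfps_scale ((-1) ^ (size (\<Sum>W\<leftarrow>T. wcontent W) + length T) * of_nat (cwbt_wt T))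
      (hprod (\<Sum>W\<leftarrow>T. wcontent W))"
proof (induction T)
  case Nil
  have "mfps_scale 1 1 = (1 :: pseries)" by simp
  then show ?case by (simp add: cwbt_wt_def hprod_def)
next
  case (Cons W T)
  then show ?case
    by (simp add: mfps_scale_mult wcoeff_def cwbt_wt_def power_add mult_ac)
qed

text \<open>Only the parity of a + b matters; its symmetry in a and b allows the lengths of shape
  and content to be exchanged.\<close>

lemma minus_one_powi_diff: "(-1 :: 'a :: field) powi (int a - int b) = (-1) ^ (a + b)"
proof -
  have "(-1 :: 'a) powi (int a - int b) = (-1) ^ a / (-1) ^ b"
    by (simp add: power_int_diff)
  then show ?thesis
    by (cases "even b") (simp_all add: power_add)
qed

theorem theorem26:
  fixes n :: nat and \<sigma> \<tau> :: otype and bs :: "tblock list"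
  assumes "n \<ge> 1"
    and "is_type n \<sigma>" and "is_type n \<tau>"
    and "mset bs = blocks \<sigma>"
  shows "htens_coeff n (polyP_type \<sigma>) \<tau> =
           (\<Sum>T\<in>cwbt bs \<tau>. cwbt_sgn \<sigma> \<tau> * of_nat (cwbt_wt T)) \<and>
         (\<Sum>T\<in>cwbt bs \<tau>. cwbt_sgn \<sigma> \<tau> * of_nat (cwbt_wt T)) =
           (-1) powi (int (tlength \<sigma>) - int (tlength \<tau>)) * (\<Sum>T\<in>cwbt bs \<tau>. of_nat (cwbt_wt T))"
proof
  let ?T = "{T. list_all2 (\<lambda>B b. B \<in> wrappings b) T bs}"
  let ?H = "hprod ` block_msets n"
  let ?c = "\<lambda>T. (-1) ^ (size (\<Sum>W\<leftarrow>T. wcontent W) + length T) * of_nat (cwbt_wt T) :: rat"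
  let ?C = "\<lambda>T. \<Sum>W\<leftarrow>T. wcontent W"
  have bsn: "mset bs \<in> block_msets n"
    using assms(2,4) blocks_in_block_msets by (simp add: is_type_def)
  then have pos: "d \<ge> 1 \<and> r \<ge> 1" if "(d, r) \<in> set bs" for d r
    using that by (auto simp: block_msets_def)
  have fin: "finite (wrappings b)" if "b \<in> set bs" for b
    using that pos[of "fst b" "snd b"] finite_wrappings[of "fst b" "snd b"] by simp
  have H: "htens ` {\<rho>. is_type n \<rho>} = ?H"
    by (simp add: htens_eq_hprod image_image flip: blocks_image_types)
  have \<tau>: "blocks \<tau> \<in> block_msets n" using assms(3) blocks_in_block_msets by (simp add: is_type_def)
  \<comment> \<open>The shape is generalized from \<open>bs\<close> to \<open>bs'\<close> for the
    induction; the inclusion of sets preserves the positivity of d and r.\<close>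
  have CT: "?C T \<in> block_msets (block_weight (mset bs'))"
    if "list_all2 (\<lambda>B b. B \<in> wrappings b) T bs'" "set bs' \<subseteq> set bs" for T bs'
    using that
  proof (induction rule: list_all2_induct)
    case (Cons W T b bs')
    then have "wcontent W \<in> block_msets (fst b * snd b)"
      using pos[of "fst b" "snd b"] wcontent_in_block_msets[of "fst b" "snd b" W] by simp
    with Cons show ?case by (auto intro: block_msets_add)
  qed (simp add: block_msets_def)
  have CT: "?C T \<in> block_msets n" if "T \<in> ?T" for T
    using CT[of T bs] that bsn by (simp add: block_msets_def)
  have "polyP_type \<sigma> = (\<Prod>b\<leftarrow>bs. polyP_block b)"
    by (simp add: polyP_type_def flip: assms(4) prod_mset_prod_list)
  also have "\<dots> = (\<Prod>b\<leftarrow>bs. \<Sum>W\<in>wrappings b. mfps_scale (wcoeff W) (hprod (wcontent W)))"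
    using pos polyP_block_expand by (intro arg_cong[where f = prod_list] map_cong) auto
  also have "\<dots> = (\<Sum>T\<in>?T. mfps_scale (?c T) (hprod (?C T)))"
    using fin by (simp add: prod_list_sum prod_list_wrappings)
  finally have P: "polyP_type \<sigma> = (\<Sum>T\<in>?T. mfps_scale (?c T) (hprod (?C T)))" .
  have ind: "\<not> mfps.dependent ?H" and inj: "inj_on hprod (block_msets n)"
    using hprod_independent_inj_on by auto
  have sp: "hprod (?C T) \<in> mfps.span ?H" if "T \<in> ?T" for T
    using CT[OF that] by (intro mfps.span_base imageI)
  have "htens_coeff n (polyP_type \<sigma>) \<tau> =
      (\<Sum>T\<in>?T. mfps.representation ?H (mfps_scale (?c T) (hprod (?C T))) (hprod (blocks \<tau>)))"
    \<comment> \<open>\<open>representation\<close> is additive only on the span and is 0 outside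
      it, so each summand must be known to lie in the span; \<open>sp\<close> supplies this.\<close>
    unfolding htens_coeff_def H P htens_eq_hprod
    by (subst mfps.representation_sum[OF ind]) (auto intro!: mfps.span_scale sp)
  also have "\<dots> = (\<Sum>T\<in>?T. if ?C T = blocks \<tau> then ?c T else 0)"
  proof (rule sum.cong)
    fix T assume T: "T \<in> ?T"
    \<comment> \<open>Injectivity of \<open>hprod\<close> is essential here: otherwise tabloids of
      another content could contribute to the same basis vector.\<close>
    have "mfps.representation ?H (hprod (?C T)) (hprod (blocks \<tau>)) =
        (if ?C T = blocks \<tau> then 1 else 0)"
      using CT[OF T] \<tau> inj by (auto simp: mfps.representation_basis[OF ind] inj_on_eq_iff)
    then show "mfps.representation ?H (mfps_scale (?c T) (hprod (?C T))) (hprod (blocks \<tau>)) =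
        (if ?C T = blocks \<tau> then ?c T else 0)"
      by (simp add: mfps.representation_scale[OF ind sp[OF T]])
  qed simp
  also have "\<dots> = (\<Sum>T\<in>cwbt bs \<tau>. ?c T)"
  proof -
    have "cwbt bs \<tau> = {T \<in> ?T. ?C T = blocks \<tau>}" by (auto simp: cwbt_def wcontent_def)
    moreover have "finite ?T" using fin by (intro finite_list_all2)
    ultimately show ?thesis by (simp only: sum.inter_filter)
  qed
  also have "\<dots> = (\<Sum>T\<in>cwbt bs \<tau>. cwbt_sgn \<sigma> \<tau> * of_nat (cwbt_wt T))"
  proof (rule sum.cong)
    fix T assume T: "T \<in> cwbt bs \<tau>"
    then have "length T = tlength \<sigma>"
      using assms(4) by (auto simp: cwbt_def tlength_eq_size_blocks dest!: list_all2_lengthD simp flip: assms(4))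
    moreover have "size (?C T) = tlength \<tau>"
      using T by (simp add: cwbt_def wcontent_def tlength_eq_size_blocks)
    ultimately show "?c T = cwbt_sgn \<sigma> \<tau> * of_nat (cwbt_wt T)"
      by (simp add: cwbt_sgn_def minus_one_powi_diff)
  qed simp
  finally show "htens_coeff n (polyP_type \<sigma>) \<tau> =
      (\<Sum>T\<in>cwbt bs \<tau>. cwbt_sgn \<sigma> \<tau> * of_nat (cwbt_wt T))" .
  show "(\<Sum>T\<in>cwbt bs \<tau>. cwbt_sgn \<sigma> \<tau> * of_nat (cwbt_wt T)) =
      (-1) powi (int (tlength \<sigma>) - int (tlength \<tau>)) * (\<Sum>T\<in>cwbt bs \<tau>. of_nat (cwbt_wt T))"
    by (simp add: cwbt_sgn_def minus_one_powi_diff add.commute sum_distrib_left)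
qed

end
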